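(* Let $\mu,\nu$ be probability measures supported on countable subsets $X$ and $Y$ of $[0,\infty)$ respectively, with $\int x\,\mu(dx)=\int y\,\nu(dy)=1$ and $\mu\preccurlyeq\nu$ in the convex order. Let $Q\in\mathcal M(\mu,\nu)$. Assume that the support of $Q$ contains, for some $n\ge2$, $n$ classical cycles $\mathcal C_1,\dots,\mathcal C_n$ such that $\left|\bigcup_{i=1}^n(\mathcal C_i)_X\right|=n$ and such that each cycle $\mathcal C_i$ contains a path which does not belong to any other cycle $\mathcal C_k$, $k\ne i$. Then $Q$ is not extremal in $\mathcal M(\mu,\nu)$.
   Context: $\mu\preccurlyeq\nu$ in the convex order means $\int c\,d\mu\le\int c\,d\nu$ for all convex $c:[0,\infty)\to\mathbb R$. $\mathcal M(\mu,\nu)$ is the set of probability measures $Q$ on $[0,\infty)^2$ with marginals $\mu,\nu$ satisfying the martingale property: if $Q(dx,dy)=q(x,dy)\mu(dx)$ then $\int y\,q(x,dy)=x$ for $\mu$-a.e. $x$. $Q\in\mathcal M(\mu,\nu)$ is extremal if $Q=\alpha Q_1+(1-\alpha)Q_2$ with $\alpha\in(0,1)$, $Q_1,Q_2\in\mathcal M(\mu,\nu)$ implies $Q=Q_1=Q_2$. The support of $Q$ is $\{(x,y)\in X\times Y:Q(\{(x,y)\})>0\}$. A path is an element $(x,y)$ of $X\times Y$. A classical cycle in a set $S\subset X\times Y$ is a finite closed sequence of paths of $S$ which alternately share their $y$-coordinate and their $x$-coordinate, with no other repetition of points; i.e. it consists, for some $m\ge2$, of the $2m$ paths $(a_1,b_1),(a_2,b_1),(a_2,b_2),(a_3,b_2),\dots,(a_m,b_m),(a_1,b_m)$,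 all in $S$, where $a_1,\dots,a_m\in X$ are distinct and $b_1,\dots,b_m\in Y$ are distinct. Its $X$-section is $\mathcal C_X=\{a_1,\dots,a_m\}$. *)

theory Defs
  imports "HOL-Probability.Probability"
begin

abbreviation halfline :: "real measure" where
  "halfline \<equiv> restrict_space borel {0..}"

text \<open>
  The integrals \<open>\<integral> c d\<mu> \<le> \<integral> c d\<nu>\<close> are to be read in \<open>(-\<infinity>, \<infinity>]\<close>. When \<open>\<mu>\<close> and \<open>\<nu>\<close> have finite
  mean, a convex \<open>c\<close> has integrable negative part, as it dominates an affine function, so the
  inequality is void if \<open>c\<close> is not \<open>\<nu>\<close>-integrable, and otherwise it forces \<open>c\<close> to be
  \<open>\<mu>\<close>-integrable.
\<close>

definition convex_order :: "real measure \<Rightarrow> real measure \<Rightarrow> bool" where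
  "convex_order \<mu> \<nu> \<longleftrightarrow>
     (\<forall>c :: real \<Rightarrow> real. convex_on {0..} c \<longrightarrow> integrable \<nu> c \<longrightarrow>
        integrable \<mu> c \<and> (\<integral>x. c x \<partial>\<mu>) \<le> (\<integral>y. c y \<partial>\<nu>))"

definition disintegrates ::
    "(real \<times> real) measure \<Rightarrow> real measure \<Rightarrow> (real \<Rightarrow> real measure) \<Rightarrow> bool" where
  "disintegrates Q \<mu> q \<longleftrightarrow>
     q \<in> halfline \<rightarrow>\<^sub>M prob_algebra halfline \<and>
     (\<forall>A \<in> sets (halfline \<Otimes>\<^sub>M halfline).
        emeasure Q A = (\<integral>\<^sup>+ x. emeasure (q x) (Pair x -` A) \<partial>\<mu>))"

text \<open>
  The kernel \<open>q\<close> always exists and is unique up to a \<open>\<mu>\<close>-null set, so quantifying it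
  existentially or universally makes no difference.
\<close>

definition martingale_couplings ::
    "real measure \<Rightarrow> real measure \<Rightarrow> (real \<times> real) measure set" where
  "martingale_couplings \<mu> \<nu> =
     {Q. prob_space Q \<and> sets Q = sets (halfline \<Otimes>\<^sub>M halfline) \<and>
         distr Q halfline fst = \<mu> \<and> distr Q halfline snd = \<nu> \<and>
         (\<exists>q. disintegrates Q \<mu> q \<and>
              (AE x in \<mu>. has_bochner_integral (q x) (\<lambda>y. y) x))}"

definition extremal_coupling ::
    "real measure \<Rightarrow> real measure \<Rightarrow> (real \<times> real) measure \<Rightarrow> bool" where
  "extremal_coupling \<mu> \<nu> Q \<longleftrightarrow>
     Q \<in> martingale_couplings \<mu> \<nu> \<and>
     (\<forall>\<alpha> :: real. \<forall>Q1 \<in> martingale_couplings \<mu> \<nu>. \<forall>Q2 \<in> martingale_couplings \<mu> \<nu>.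
        0 < \<alpha> \<longrightarrow> \<alpha> < 1 \<longrightarrow>
        (\<forall>A \<in> sets Q. measure Q A = \<alpha> * measure Q1 A + (1 - \<alpha>) * measure Q2 A) \<longrightarrow>
        Q = Q1 \<and> Q = Q2)"

definition coupling_support ::
    "real set \<Rightarrow> real set \<Rightarrow> (real \<times> real) measure \<Rightarrow> (real \<times> real) set" where
  "coupling_support X Y Q = {p \<in> X \<times> Y. measure Q {p} > 0}"

text \<open>
  A cycle is represented by its set of paths; the points are numbered \<open>0, \<dots>, m - 1\<close>, and the last
  path \<open>(a 0, b (m - 1))\<close> closes the cycle.
\<close>

definition classical_cycle :: "('a \<times> 'b) set \<Rightarrow> ('a \<times> 'b) set \<Rightarrow> bool" where
  "classical_cycle S C \<longleftrightarrow>
     (\<exists>(m::nat) a b. m \<ge> 2 \<and> inj_on a {..<m} \<and> inj_on b {..<m} \<and>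
        C = (\<Union>i<m. {(a i, b i), (a (Suc i mod m), b i)}) \<and> C \<subseteq> S)"

definition X_section :: "('a \<times> 'b) set \<Rightarrow> 'a set" where
  "X_section C = fst ` C"

end

theory Submission
  imports Defs
begin

text \<open>
  Giving the paths of a cycle alternating signs yields a weight on the support of \<open>Q\<close> whose row and
  column sums all vanish. Requiring in addition that a combination of the \<open>n\<close> weights has vanishing
  barycentre in each of the \<open>n\<close> rows concerned imposes \<open>n\<close> linear conditions on \<open>n\<close> coefficients, but
  these are dependent: the barycentres of all rows add up to zero because the column sums do. So
  there is a nontrivial solution \<open>w\<close>, which is not zero as a weight because every cycle has a path of
  its own, and \<open>Q\<close> is the midpoint of the martingale couplings \<open>Q + \<epsilon> w\<close> and \<open>Q - \<epsilon> w\<close>.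
\<close>

section \<open>Homogeneous linear systems with more unknowns than equations\<close>

lemma underdetermined_linear_system:
  fixes v :: "'i \<Rightarrow> 'a \<Rightarrow> 'k :: field"
  assumes "finite A" "finite I" "card A < card I"
  shows "\<exists>l. (\<exists>i\<in>I. l i \<noteq> 0) \<and> (\<forall>x\<in>A. (\<Sum>i\<in>I. l i * v i x) = 0)"
  using assms
proof (induction A arbitrary: I v rule: finite_induct)
  case empty
  then have "I \<noteq> {}" by auto
  then show ?case by (intro exI[of _ "\<lambda>_. 1"]) auto
next
  case (insert x A)
  show ?case
  proof (cases "\<forall>i\<in>I. v i x = 0")
    case True
    from insert.hyps insert.prems have "card A < card I" by simp
    from insert.IH[OF insert.prems(1) this, of v] True show ?thesis
      by (auto intro!: sum.neutral)
  next
    case False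
    then obtain j where j: "j \<in> I" "v j x \<noteq> 0" by blast
    define J where "J = I - {j}"
    have J: "finite J" "j \<notin> J" "I = insert j J"
      using j insert.prems by (auto simp: J_def)
    have "card A < card J"
      using J insert.hyps insert.prems by simp
    from insert.IH[OF J(1) this, of "\<lambda>i y. v i y - v i x / v j x * v j y"]
    obtain l where l: "\<exists>i\<in>J. l i \<noteq> 0"
      "\<forall>y\<in>A. (\<Sum>i\<in>J. l i * (v i y - v i x / v j x * v j y)) = 0"
      by blast
    \<comment> \<open>The value at the pivot index \<open>j\<close> is the one that equation
      \<open>x\<close> dictates.\<close>
    define l' where "l' = l(j := - (\<Sum>i\<in>J. l i * v i x) / v j x)"
    \<comment> \<open>For \<open>y = x\<close> all reduced coefficients vanish, so the pivot
      equation holds whatever \<open>l\<close> is; for \<open>y\<close> in \<open>A\<close> the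
      right-hand sides are the equations solved by \<open>l\<close>.\<close>
    have *: "(\<Sum>i\<in>I. l' i * v i y) = (\<Sum>i\<in>J. l i * (v i y - v i x / v j x * v j y))" for y
    proof -
      have "(\<Sum>i\<in>J. l' i * v i y) = (\<Sum>i\<in>J. l i * v i y)"
        using J by (intro sum.cong) (auto simp: l'_def)
      then have "(\<Sum>i\<in>I. l' i * v i y)
          = - (\<Sum>i\<in>J. l i * v i x) / v j x * v j y + (\<Sum>i\<in>J. l i * v i y)"
        using J by (simp add: l'_def)
      also have "\<dots> = (\<Sum>i\<in>J. l i * (v i y - v i x / v j x * v j y))"
        by (simp add: algebra_simps sum_subtractf sum_distrib_left sum_distrib_right
            sum_divide_distrib)
      finally show ?thesis .
    qed
    have "\<exists>i\<in>I. l' i \<noteq> 0"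
      using l(1) J by (auto simp: l'_def)
    moreover have "(\<Sum>i\<in>I. l' i * v i y) = 0" if "y \<in> insert x A" for y
      using that l(2) j by (auto simp: *)
    ultimately show ?thesis by blast
  qed
qed

section \<open>The signed weight of a classical cycle\<close>

text \<open>The weight is \<open>1\<close> on the paths \<open>(a i, b i)\<close> and
  \<open>- 1\<close> on the paths \<open>(a (Suc i mod m), b i)\<close>; every row and every column
  of the cycle contains one path of each sign. Quantifying over \<open>g\<close> expresses at once
  that all row sums and all column sums vanish.\<close>

lemma classical_cycle_weight:
  assumes "classical_cycle S C"
  obtains w :: "'a \<times> 'b \<Rightarrow> real"
  where "finite C" "\<And>p. w p \<noteq> 0 \<longleftrightarrow> p \<in> C"
    "\<And>g. (\<Sum>p\<in>C. w p * g (fst p)) = 0" "\<And>g. (\<Sum>p\<in>C. w p * g (snd p)) = 0"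
proof -
  from assms obtain m :: nat and a b where m: "m \<ge> 2" and inj: "inj_on a {..<m}" "inj_on b {..<m}"
    and C: "C = (\<Union>i<m. {(a i, b i), (a (Suc i mod m), b i)})"
    unfolding classical_cycle_def by blast
  have succ_less: "Suc i mod m < m" for i using m by simp
  \<comment> \<open>This is where \<open>m \<ge> 2\<close> matters: the cyclic shift then has no
    fixed point.\<close>
  have succ_neq: "Suc i mod m \<noteq> i" if "i < m" for i
    using m that by (cases "Suc i = m") auto
  have succ_inj: "inj_on (\<lambda>i. Suc i mod m) {..<m}"
  proof (rule inj_onI)
    fix i j assume "i \<in> {..<m}" "j \<in> {..<m}" "Suc i mod m = Suc j mod m"
    then show "i = j"
      by (cases "Suc i = m"; cases "Suc j = m") auto
  qed
  have succ_image: "(\<lambda>i. Suc i mod m) ` {..<m} = {..<m}"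
    using succ_inj succ_less by (intro endo_inj_surj) auto
  define P where "P = (\<lambda>i. (a i, b i)) ` {..<m}"
  define N where "N = (\<lambda>i. (a (Suc i mod m), b i)) ` {..<m}"
  have inj_P: "inj_on (\<lambda>i. (a i, b i)) {..<m}" and
    inj_N: "inj_on (\<lambda>i. (a (Suc i mod m), b i)) {..<m}"
    using inj by (auto simp: inj_on_def)
  \<comment> \<open>No path receives both signs: equal second coordinates force
    \<open>i = j\<close>, and equal first coordinates would then make \<open>j\<close> a fixed point
    of the shift.\<close>
  have disj: "P \<inter> N = {}"
  proof -
    have False if "i < m" "j < m" "a i = a (Suc j mod m)" "b i = b j" for i j
      using that inj_onD[OF inj(1) that(3)] inj_onD[OF inj(2) that(4)] succ_less succ_neq by auto
    then show ?thesis by (auto simp: P_def N_def)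
  qed
  have CPN: "C = P \<union> N" by (auto simp: C P_def N_def)
  have fin: "finite P" "finite N" by (auto simp: P_def N_def)
  define w where "w = (\<lambda>p. (if p \<in> P then 1 else if p \<in> N then - 1 else 0) :: real)"
  have sum: "(\<Sum>p\<in>C. w p * h p)
      = (\<Sum>i<m. h (a i, b i)) - (\<Sum>i<m. h (a (Suc i mod m), b i))" for h
  proof -
    have "(\<Sum>p\<in>C. w p * h p) = (\<Sum>p\<in>P. w p * h p) + (\<Sum>p\<in>N. w p * h p)"
      unfolding CPN by (rule sum.union_disjoint) (use fin disj in auto)
    also have "(\<Sum>p\<in>P. w p * h p) = (\<Sum>p\<in>P. h p)"
      by (rule sum.cong) (auto simp: w_def)
    also have "(\<Sum>p\<in>N. w p * h p) = (\<Sum>p\<in>N. - h p)"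
      by (rule sum.cong) (use disj in \<open>auto simp: w_def\<close>)
    finally show ?thesis
      by (simp add: P_def N_def sum.reindex[OF inj_P] sum.reindex[OF inj_N] sum_negf)
  qed
  show thesis
  proof (rule that[of w])
    show "finite C" using fin by (simp add: CPN)
    show "w p \<noteq> 0 \<longleftrightarrow> p \<in> C" for p by (auto simp: w_def CPN)
    show "(\<Sum>p\<in>C. w p * g (snd p)) = 0" for g by (simp add: sum)
    \<comment> \<open>The columns cancel term by term, the rows only after reindexing by the cyclic
      shift, a permutation of the indices.\<close>
    have "(\<Sum>i<m. g (a (Suc i mod m))) = (\<Sum>i<m. g (a i))" for g :: "'a \<Rightarrow> real"
      using sum.reindex[OF succ_inj, of "\<lambda>i. g (a i)"] by (simp add: succ_image)
    then show "(\<Sum>p\<in>C. w p * g (fst p)) = 0" for g by (simp add: sum)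
  qed
qed

section \<open>Reweighting finitely many atoms, and disintegration\<close>

text \<open>The factor differs from \<open>1\<close> only at the points \<open>k r\<close>, so the
  integral changes by a sum over atoms. The map \<open>k\<close> need not be injective: it will be
  \<open>snd\<close> on a set of paths, several of which may share a column.\<close>

lemma has_bochner_integral_reweight_atoms:
  fixes g :: "'a \<Rightarrow> real"
  assumes "finite_measure N" "has_bochner_integral N g I" "\<And>r. r \<in> F \<Longrightarrow> {k r} \<in> sets N"
  shows "has_bochner_integral N (\<lambda>y. g y * (1 + (\<Sum>r\<in>F. c r * indicator {k r} y)))
           (I + (\<Sum>r\<in>F. c r * g (k r) * measure N {k r}))"
proof -
  interpret finite_measure N by fact
  have "has_bochner_integral N (\<lambda>y. g y + (\<Sum>r\<in>F. c r * g (k r) * indicator {k r} y))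
           (I + (\<Sum>r\<in>F. c r * g (k r) * measure N {k r}))"
    using assms
    by (intro has_bochner_integral_add has_bochner_integral_sum has_bochner_integral_mult_right
        has_bochner_integral_real_indicator) (auto simp: emeasure_eq_measure)
  moreover have "g y + (\<Sum>r\<in>F. c r * g (k r) * indicator {k r} y)
      = g y * (1 + (\<Sum>r\<in>F. c r * indicator {k r} y))" for y
    by (auto simp: algebra_simps sum_distrib_left indicator_def intro!: sum.cong)
  ultimately show ?thesis by simp
qed

text \<open>\<open>Q\<close> is the bind of \<open>\<mu>\<close> with the kernel that sends
  \<open>x\<close> to the image of \<open>q x\<close> under \<open>Pair x\<close>, so the formula is
  the one for integrals against a bind.\<close>

lemma nn_integral_disintegrates:
  assumes "disintegrates Q \<mu> q" "prob_space \<mu>" "sets \<mu> = sets halfline"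
    "sets Q = sets (halfline \<Otimes>\<^sub>M halfline)" "f \<in> borel_measurable (halfline \<Otimes>\<^sub>M halfline)"
  shows "(\<integral>\<^sup>+p. f p \<partial>Q) = (\<integral>\<^sup>+x. \<integral>\<^sup>+y. f (x, y) \<partial>q x \<partial>\<mu>)"
proof -
  interpret \<mu>: prob_space \<mu> by fact
  define K where "K = (\<lambda>x. distr (q x) (halfline \<Otimes>\<^sub>M halfline) (Pair x))"
  have q: "q \<in> halfline \<rightarrow>\<^sub>M subprob_algebra halfline"
    using assms(1) by (auto simp: disintegrates_def intro: measurable_prob_algebraD)
  have "K \<in> halfline \<rightarrow>\<^sub>M subprob_algebra (halfline \<Otimes>\<^sub>M halfline)"
    unfolding K_def by (rule measurable_distr2[OF _ q]) simp
  then have K: "K \<in> \<mu> \<rightarrow>\<^sub>M subprob_algebra (halfline \<Otimes>\<^sub>M halfline)"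
    using measurable_cong_sets[OF assms(3) refl] by blast
  have sp: "space \<mu> = space halfline" by (rule sets_eq_imp_space_eq) fact
  have sq: "sets (q x) = sets halfline" if "x \<in> space \<mu>" for x
    using subprob_measurableD(2)[OF q] that by (simp add: sp)
  have Pm: "Pair x \<in> q x \<rightarrow>\<^sub>M halfline \<Otimes>\<^sub>M halfline" if "x \<in> space \<mu>" for x
    unfolding measurable_cong_sets[OF sq[OF that] refl]
    using that by (intro measurable_Pair1') (simp only: sp)
  have "Q = \<mu> \<bind> K"
  proof (rule measure_eqI)
    show "sets Q = sets (\<mu> \<bind> K)"
      using K \<mu>.not_empty by (simp add: assms(4) sets_bind[OF sets_kernel[OF K]])
    fix A assume A: "A \<in> sets Q"
    have "emeasure Q A = (\<integral>\<^sup>+ x. emeasure (q x) (Pair x -` A) \<partial>\<mu>)"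
      using assms(1) A by (auto simp: disintegrates_def assms(4))
    also have "\<dots> = (\<integral>\<^sup>+ x. emeasure (K x) A \<partial>\<mu>)"
    proof (rule nn_integral_cong)
      fix x assume x: "x \<in> space \<mu>"
      have "Pair x -` A \<in> sets (q x)"
        using sets_Pair1[of A halfline halfline x] A by (simp add: assms(4) sq[OF x])
      then have "Pair x -` A \<inter> space (q x) = Pair x -` A"
        using sets.sets_into_space by blast
      then show "emeasure (q x) (Pair x -` A) = emeasure (K x) A"
        unfolding K_def using A by (simp add: emeasure_distr[OF Pm[OF x]] assms(4))
    qed
    also have "\<dots> = emeasure (\<mu> \<bind> K) A"
      using \<mu>.not_empty K A by (simp add: emeasure_bind assms(4))
    finally show "emeasure Q A = emeasure (\<mu> \<bind> K) A" .
  qed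
  then have "(\<integral>\<^sup>+p. f p \<partial>Q) = (\<integral>\<^sup>+x. \<integral>\<^sup>+p. f p \<partial>K x \<partial>\<mu>)"
    using nn_integral_bind[OF assms(5) K] by simp
  also have "\<dots> = (\<integral>\<^sup>+x. \<integral>\<^sup>+y. f (x, y) \<partial>q x \<partial>\<mu>)"
    unfolding K_def by (intro nn_integral_cong) (simp add: nn_integral_distr Pm assms(5))
  finally show ?thesis .
qed

text \<open>Only the slice over \<open>x\<close> is nonempty. This translates atoms of the coupling
  into atoms of its kernel.\<close>

lemma emeasure_disintegrates_singleton:
  assumes "disintegrates Q \<mu> q" "sets \<mu> = sets halfline" "x \<ge> 0" "y \<ge> 0"
  shows "emeasure Q {(x, y)} = emeasure (q x) {y} * emeasure \<mu> {x}"
proof -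
  have sing: "{z} \<in> sets halfline" if "z \<ge> 0" for z :: real
    using that by (auto simp: sets_restrict_space_iff)
  have "{x} \<times> {y} \<in> sets (halfline \<Otimes>\<^sub>M halfline)"
    using sing assms by (intro pair_measureI) auto
  then have "{(x, y)} \<in> sets (halfline \<Otimes>\<^sub>M halfline)" by simp
  then have "emeasure Q {(x, y)} = (\<integral>\<^sup>+ z. emeasure (q z) (Pair z -` {(x, y)}) \<partial>\<mu>)"
    using assms(1) by (auto simp: disintegrates_def)
  also have "\<dots> = (\<integral>\<^sup>+ z. emeasure (q x) {y} * indicator {x} z \<partial>\<mu>)"
  proof (rule nn_integral_cong)
    fix z
    have "Pair z -` {(x, y)} = (if z = x then {y} else {})" by auto
    then show "emeasure (q z) (Pair z -` {(x, y)}) = emeasure (q x) {y} * indicator {x} z"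
      by simp
  qed
  also have "\<dots> = emeasure (q x) {y} * emeasure \<mu> {x}"
    using sing assms by (intro nn_integral_cmult_indicator) auto
  finally show ?thesis .
qed

text \<open>Serves twice: for the coupling, with \<open>k\<close> the identity, and for each kernel
  measure, with \<open>k = snd\<close>. The masses of sets are the integrals of indicators.\<close>

lemma density_reweight_atoms:
  fixes c :: "'r \<Rightarrow> real" and k :: "'r \<Rightarrow> 'a"
  assumes "finite_measure N" "\<And>r. r \<in> F \<Longrightarrow> {k r} \<in> sets N"
    and nonneg: "\<And>y. 1 + (\<Sum>r\<in>F. c r * indicator {k r} y) \<ge> 0"
  defines "N' \<equiv> density N (\<lambda>y. ennreal (1 + (\<Sum>r\<in>F. c r * indicator {k r} y)))"
  shows "has_bochner_integral N g I \<Longrightarrow>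
      has_bochner_integral N' g (I + (\<Sum>r\<in>F. c r * g (k r) * measure N {k r}))"
    and "A \<in> sets N \<Longrightarrow> emeasure N' A =
      ennreal (measure N A + (\<Sum>r\<in>F. c r * indicator A (k r) * measure N {k r}))"
    and "A \<in> sets N \<Longrightarrow> measure N' A =
      measure N A + (\<Sum>r\<in>F. c r * indicator A (k r) * measure N {k r})"
proof -
  interpret finite_measure N by fact
  have *: "has_bochner_integral N' g (I + (\<Sum>r\<in>F. c r * g (k r) * measure N {k r}))"
    if g: "has_bochner_integral N g I" for g :: "'a \<Rightarrow> real" and I
  proof -
    have "g \<in> borel_measurable N"
      using g by (auto simp: has_bochner_integral_iff)
    moreover have "(\<lambda>y. 1 + (\<Sum>r\<in>F. c r * indicator {k r} y)) \<in> borel_measurable N"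
      using assms(2) by (intro borel_measurable_add borel_measurable_sum borel_measurable_times
          borel_measurable_indicator) auto
    ultimately show ?thesis
      unfolding N'_def
      using has_bochner_integral_reweight_atoms[OF assms(1) g assms(2), where c = c] nonneg
      by (intro has_bochner_integral_density) (auto simp: mult.commute)
  qed
  then show "has_bochner_integral N g I \<Longrightarrow>
      has_bochner_integral N' g (I + (\<Sum>r\<in>F. c r * g (k r) * measure N {k r}))" .
  assume A: "A \<in> sets N"
  have "has_bochner_integral N (indicator A) (measure N A)"
    using A by (intro has_bochner_integral_real_indicator) (auto simp: emeasure_eq_measure)
  from *[OF this] have "integrable N' (indicator A :: 'a \<Rightarrow> real)"
    and I: "integral\<^sup>L N' (indicator A)
      = measure N A + (\<Sum>r\<in>F. c r * indicator A (k r) * measure N {k r})"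
    by (auto simp: has_bochner_integral_iff)
  moreover have A': "A \<in> sets N'" using A by (simp add: N'_def)
  \<comment> \<open>Finiteness, read off from the integrable indicator, allows passing from
    \<open>measure\<close> to \<open>emeasure\<close>.\<close>
  ultimately have "emeasure N' A < \<infinity>"
    by (simp add: integrable_indicator_iff sets.Int_space_eq2)
  moreover have "integral\<^sup>L N' (indicator A) = measure N' A"
    using A' by (simp add: sets.Int_space_eq2)
  ultimately show "emeasure N' A =
      ennreal (measure N A + (\<Sum>r\<in>F. c r * indicator A (k r) * measure N {k r}))"
    "measure N' A = measure N A + (\<Sum>r\<in>F. c r * indicator A (k r) * measure N {k r})"
    using I by (auto simp: emeasure_eq_ennreal_measure)
qed

section \<open>Perturbing a martingale coupling by a signed weight\<close>

text \<open>\<open>Q'\<close> has a density with respect to \<open>Q\<close> that moves the mass of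
  each \<open>p\<close> in \<open>F\<close> by \<open>w p\<close>. The bound on \<open>w\<close>
  keeps it nonnegative, \<open>row\<close> and \<open>col\<close> preserve the marginals, and
  \<open>bary\<close> preserves the barycentres of the kernel.\<close>

lemma martingale_coupling_perturb:
  fixes w :: "real \<times> real \<Rightarrow> real"
  assumes "prob_space \<mu>" "sets \<mu> = sets halfline" "Q \<in> martingale_couplings \<mu> \<nu>"
    and "finite F" "F \<subseteq> {0..} \<times> {0..}"
    and pos: "\<And>p. p \<in> F \<Longrightarrow> measure Q {p} > 0"
    and small: "\<And>p. p \<in> F \<Longrightarrow> \<bar>w p\<bar> \<le> measure Q {p}"
    and row: "\<And>g. (\<Sum>p\<in>F. w p * g (fst p)) = 0"
    and col: "\<And>g. (\<Sum>p\<in>F. w p * g (snd p)) = 0"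
    and bary: "\<And>x. (\<Sum>p\<in>F. w p * (of_bool (fst p = x) * snd p)) = 0"
  obtains Q' where "Q' \<in> martingale_couplings \<mu> \<nu>"
    "\<And>A. A \<in> sets Q \<Longrightarrow> measure Q' A = measure Q A + (\<Sum>p\<in>F. w p * indicator A p)"
proof -
  from assms(3) obtain q where "prob_space Q"
    and sets_Q: "sets Q = sets (halfline \<Otimes>\<^sub>M halfline)"
    and marg: "distr Q halfline fst = \<mu>" "distr Q halfline snd = \<nu>"
    and q: "disintegrates Q \<mu> q"
    and mart: "AE x in \<mu>. has_bochner_integral (q x) (\<lambda>y. y) x"
    unfolding martingale_couplings_def by blast
  interpret Q: prob_space Q by fact
  interpret \<mu>: prob_space \<mu> by fact
  have space_\<mu>: "space \<mu> = {0..}"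
    using sets_eq_imp_space_eq[OF assms(2)] by simp
  have space_Q: "space Q = {0..} \<times> {0..}"
    using sets_eq_imp_space_eq[OF sets_Q] by (simp add: space_pair_measure)
  have sing: "{z} \<in> sets halfline" if "z \<ge> 0" for z :: real
    using that by (auto simp: sets_restrict_space_iff)
  \<comment> \<open>A set outside the sigma-algebra has measure \<open>0\<close> by convention, so
    positive mass implies measurability.\<close>
  have sing_Q: "{r} \<in> sets Q" if "r \<in> F" for r
    using pos[OF that] by (rule_tac ccontr) (simp add: measure_notin_sets)
  define c where "c r = w r / measure Q {r}" for r
  define f where "f p = 1 + (\<Sum>r\<in>F. c r * indicator {r} p)" for p
  have f_nonneg: "f p \<ge> 0" for p
  proof -
    have "(\<Sum>r\<in>F. c r * indicator {r} p) = (if p \<in> F then c p else 0)"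
      using assms(4) by (simp add: indicator_def sum.delta)
    moreover have "c p \<ge> - 1" if "p \<in> F"
      using pos[OF that] small[OF that] by (simp add: c_def field_simps)
    ultimately show ?thesis by (force simp: f_def)
  qed
  define Q' where "Q' = density Q (\<lambda>p. ennreal (f p))"
  have Q': "emeasure Q' A = ennreal (measure Q A + (\<Sum>r\<in>F. w r * indicator A r))"
    "measure Q' A = measure Q A + (\<Sum>r\<in>F. w r * indicator A r)" if "A \<in> sets Q" for A
  proof -
    have "(\<Sum>r\<in>F. c r * indicator A r * measure Q {r}) = (\<Sum>r\<in>F. w r * indicator A r)"
    proof (rule sum.cong)
      fix r assume "r \<in> F"
      from pos[OF this]
      show "c r * indicator A r * measure Q {r} = w r * indicator A r"
        by (simp add: c_def)
    qed simp
    then show "emeasure Q' A = ennreal (measure Q A + (\<Sum>r\<in>F. w r * indicator A r))"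
      "measure Q' A = measure Q A + (\<Sum>r\<in>F. w r * indicator A r)"
      using density_reweight_atoms(2,3)[of Q F "\<lambda>r. r" c A] sing_Q f_nonneg that
      by (auto simp: Q'_def f_def Q.finite_measure_axioms)
  qed
  \<comment> \<open>Both marginals are treated together: the preimage of \<open>B\<close> gains the
    weight sum with \<open>g\<close> the indicator of \<open>B\<close>, which vanishes.\<close>
  have distr_Q': "distr Q' halfline \<phi> = distr Q halfline \<phi>"
    if "\<phi> \<in> halfline \<Otimes>\<^sub>M halfline \<rightarrow>\<^sub>M halfline" "\<And>g. (\<Sum>p\<in>F. w p * g (\<phi> p)) = 0"
    for \<phi> :: "real \<times> real \<Rightarrow> real"
  proof (rule measure_eqI)
    fix B assume "B \<in> sets (distr Q' halfline \<phi>)"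
    then have B: "B \<in> sets halfline" by simp
    have m: "\<phi> \<in> Q \<rightarrow>\<^sub>M halfline" "\<phi> \<in> Q' \<rightarrow>\<^sub>M halfline"
      using that(1) measurable_cong_sets[OF sets_Q refl, of halfline] by (auto simp: Q'_def)
    have "(\<Sum>r\<in>F. w r * indicator (\<phi> -` B \<inter> space Q) r) = (\<Sum>r\<in>F. w r * indicator B (\<phi> r))"
      using assms(5) by (intro sum.cong) (auto simp: indicator_def space_Q)
    also have "\<dots> = 0" by (rule that(2))
    finally have "emeasure Q' (\<phi> -` B \<inter> space Q) = emeasure Q (\<phi> -` B \<inter> space Q)"
      using Q'(1)[OF measurable_sets[OF m(1) B]] by (simp add: Q.emeasure_eq_measure)
    then show "emeasure (distr Q' halfline \<phi>) B = emeasure (distr Q halfline \<phi>) B"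
      using m B by (simp add: emeasure_distr Q'_def)
  qed simp
  have marg': "distr Q' halfline fst = \<mu>" "distr Q' halfline snd = \<nu>"
    using distr_Q'[of fst] distr_Q'[of snd] row col marg by simp_all
  \<comment> \<open>The total mass can be read off from the first marginal
    \<open>\<mu>\<close>.\<close>
  have "prob_space Q'"
    using prob_space_distrD[of fst Q' halfline] marg' assms(1)
      measurable_cong_sets[OF sets_Q refl, of halfline]
    by (simp add: Q'_def)

  have qx: "sets (q x) = sets halfline" "prob_space (q x)" if "x \<ge> 0" for x
    using q measurable_space[of q halfline "prob_algebra halfline" x] that
    by (auto simp: disintegrates_def space_prob_algebra)
  define q' where "q' x = density (q x) (\<lambda>y. ennreal (f (x, y)))" for x
  define d where "d x r = c r * of_bool (fst r = x)" for x r
  have f_Pair: "f (x, y) = 1 + (\<Sum>r\<in>F. d x r * indicator {snd r} y)" for x y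
    by (auto simp: f_def d_def indicator_def intro!: sum.cong)
  \<comment> \<open>Atoms of \<open>q x\<close> are atoms of \<open>Q\<close> divided by
    \<open>measure \<mu> {x}\<close>, so corrections in row \<open>x\<close> become row sums of
    \<open>w\<close>. If \<open>F\<close> meets row \<open>x\<close>, then \<open>\<mu>\<close>
    charges \<open>x\<close> because \<open>Q\<close> charges that path; otherwise both sides are
    \<open>0\<close>.\<close>
  have d_sum: "(\<Sum>r\<in>F. d x r * g r * measure (q x) {snd r})
      = (\<Sum>r\<in>F. w r * (of_bool (fst r = x) * g r)) / measure \<mu> {x}" if x: "x \<ge> 0" for x g
    unfolding sum_divide_distrib
  proof (rule sum.cong)
    fix r assume r: "r \<in> F"
    show "d x r * g r * measure (q x) {snd r}
        = w r * (of_bool (fst r = x) * g r) / measure \<mu> {x}"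
    proof (cases "fst r = x")
      case True
      interpret qx: prob_space "q x" by (rule qx) fact
      have "emeasure Q {(x, snd r)} = emeasure (q x) {snd r} * emeasure \<mu> {x}"
        using r assms(5) x by (intro emeasure_disintegrates_singleton[OF q assms(2)]) auto
      then have "measure Q {r} = measure (q x) {snd r} * measure \<mu> {x}"
        using True by (auto simp: measure_def enn2real_mult)
      with pos[OF r] True show ?thesis
        by (auto simp: d_def c_def divide_simps)
    qed (simp add: d_def)
  qed simp
  have q'_int: "has_bochner_integral (q' x) g (I + (\<Sum>r\<in>F. d x r * g (snd r) * measure (q x) {snd r}))"
    if "x \<ge> 0" "has_bochner_integral (q x) g I" for x g I
    unfolding q'_def f_Pair
  proof (rule density_reweight_atoms(1))
    show "finite_measure (q x)" using qx that by (intro prob_space.finite_measure)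
    show "{snd r} \<in> sets (q x)" if "r \<in> F" for r
      using that assms(5) sing by (auto simp: qx \<open>x \<ge> 0\<close>)
    show "1 + (\<Sum>r\<in>F. d x r * indicator {snd r} y) \<ge> 0" for y
      using f_nonneg[of "(x, y)"] by (simp add: f_Pair)
  qed fact
  have "prob_space (q' x)" if x: "x \<ge> 0" for x
  proof
    interpret qx: prob_space "q x" by (rule qx) fact
    have "has_bochner_integral (q x) (\<lambda>_. 1) (1 :: real)"
      by (simp add: has_bochner_integral_iff qx.prob_space)
    from q'_int[OF x this] have "has_bochner_integral (q' x) (\<lambda>_. 1) (1 :: real)"
      using row[of "\<lambda>z. of_bool (z = x)"] d_sum[OF x, of "\<lambda>_. 1"] by simp
    then have "measure (q' x) (space (q' x)) = 1"
      by (auto simp: has_bochner_integral_iff)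
    \<comment> \<open>\<open>measure\<close> is \<open>0\<close> on sets of infinite mass, so the
      value \<open>1\<close> rules out infinite mass.\<close>
    then show "emeasure (q' x) (space (q' x)) = 1"
      by (metis emeasure_eq_ennreal_measure ennreal_1 measure_zero_top zero_neq_one)
  qed
  then have q'_space: "q' x \<in> space (prob_algebra halfline)" if "x \<ge> 0" for x
    using that by (simp add: space_prob_algebra q'_def qx)
  have "q' \<in> halfline \<rightarrow>\<^sub>M prob_algebra halfline"
  proof (rule measurable_discrete_difference[of q])
    show "countable (fst ` F)" using assms(4) by (simp add: countable_finite)
    show "{x} \<in> sets halfline" if "x \<in> fst ` F" for x
      using that assms(5) by (intro sing) auto
    show "q' x \<in> space (prob_algebra halfline)" if "x \<in> fst ` F" for x
      using that assms(5) by (intro q'_space) auto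
    show "q x = q' x" if "x \<notin> fst ` F" for x
    proof -
      have "d x r = 0" if "r \<in> F" for r
        using that \<open>x \<notin> fst ` F\<close> by (cases "fst r = x") (auto simp: d_def)
      then have "f (x, y) = 1" for y
        by (simp add: f_Pair)
      then show ?thesis by (simp add: q'_def density_1)
    qed
  qed (use q in \<open>simp add: disintegrates_def\<close>)
  \<comment> \<open>Disintegrating \<open>Q\<close> in the integral of its density over
    \<open>A\<close> leaves the slice of \<open>f\<close> in the inner integral, which is the
    density defining \<open>q' x\<close>.\<close>
  moreover have "emeasure Q' A = (\<integral>\<^sup>+ x. emeasure (q' x) (Pair x -` A) \<partial>\<mu>)"
    if A: "A \<in> sets (halfline \<Otimes>\<^sub>M halfline)" for A
  proof -
    have f_Q: "f \<in> borel_measurable Q"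
      unfolding f_def using sing_Q
      by (intro borel_measurable_add borel_measurable_sum borel_measurable_times
          borel_measurable_indicator) auto
    then have f: "f \<in> borel_measurable (halfline \<Otimes>\<^sub>M halfline)"
      using measurable_cong_sets[OF sets_Q refl] by blast
    have "emeasure Q' A = (\<integral>\<^sup>+ p. ennreal (f p) * indicator A p \<partial>Q)"
      unfolding Q'_def using A f_Q by (intro emeasure_density) (auto simp: sets_Q)
    also have "\<dots> = (\<integral>\<^sup>+ x. \<integral>\<^sup>+ y. ennreal (f (x, y)) * indicator A (x, y) \<partial>q x \<partial>\<mu>)"
      using f A
      by (intro nn_integral_disintegrates[OF q assms(1,2) sets_Q] borel_measurable_times_ennreal
          borel_measurable_indicator measurable_compose[OF f measurable_ennreal])
    also have "\<dots> = (\<integral>\<^sup>+ x. emeasure (q' x) (Pair x -` A) \<partial>\<mu>)"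
    proof (rule nn_integral_cong)
      fix x assume "x \<in> space \<mu>"
      then have x: "x \<ge> 0" by (simp add: space_\<mu>)
      have "(\<lambda>y. f (x, y)) \<in> borel_measurable halfline"
        using x by (intro measurable_compose[OF measurable_Pair1' f]) simp
      then have "(\<lambda>y. f (x, y)) \<in> borel_measurable (q x)"
        using measurable_cong_sets[OF qx(1)[OF x] refl, of "borel :: real measure"] by simp
      moreover have "Pair x -` A \<in> sets (q x)"
        using sets_Pair1[OF A] by (simp add: qx x)
      ultimately show "(\<integral>\<^sup>+ y. ennreal (f (x, y)) * indicator A (x, y) \<partial>q x)
          = emeasure (q' x) (Pair x -` A)"
        by (simp add: q'_def emeasure_density indicator_def)
    qed
    finally show ?thesis .
  qed
  ultimately have "disintegrates Q' \<mu> q'"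
    by (simp add: disintegrates_def)
  \<comment> \<open>The barycentre of row \<open>x\<close> changes by the sum in \<open>bary\<close>
    divided by \<open>measure \<mu> {x}\<close>, hence not at all.\<close>
  moreover have "AE x in \<mu>. has_bochner_integral (q' x) (\<lambda>y. y) x"
    using mart
  proof (rule AE_mp, intro AE_I2 impI)
    fix x assume "x \<in> space \<mu>" and int: "has_bochner_integral (q x) (\<lambda>y. y) x"
    then have x: "x \<ge> 0" by (simp add: space_\<mu>)
    show "has_bochner_integral (q' x) (\<lambda>y. y) x"
      using q'_int[OF x int] bary d_sum[OF x, of snd] by simp
  qed
  ultimately have "Q' \<in> martingale_couplings \<mu> \<nu>"
    using marg' \<open>prob_space Q'\<close> by (auto simp: martingale_couplings_def Q'_def sets_Q)
  then show thesis using Q'(2) by (rule that)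
qed

section \<open>Combining the cycle weights\<close>

theorem proposition7p8:
  fixes \<mu> \<nu> :: "real measure" and X Y :: "real set"
    and Q :: "(real \<times> real) measure"
    and n :: nat and C :: "nat \<Rightarrow> (real \<times> real) set"
  assumes "prob_space \<mu>" and "sets \<mu> = sets halfline"
    and "prob_space \<nu>" and "sets \<nu> = sets halfline"
    and "countable X" and "X \<subseteq> {0..}" and "measure \<mu> X = 1"
    and "countable Y" and "Y \<subseteq> {0..}" and "measure \<nu> Y = 1"
    and "has_bochner_integral \<mu> (\<lambda>x. x) 1"
    and "has_bochner_integral \<nu> (\<lambda>y. y) 1"
    and "convex_order \<mu> \<nu>"
    and "Q \<in> martingale_couplings \<mu> \<nu>"
    and "n \<ge> 2"
    and "\<forall>i\<in>{1..n}. classical_cycle (coupling_support X Y Q) (C i)"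
    and "card (\<Union>i\<in>{1..n}. X_section (C i)) = n"
    and "\<forall>i\<in>{1..n}. \<exists>p\<in>C i. \<forall>k\<in>{1..n}. k \<noteq> i \<longrightarrow> p \<notin> C k"
  shows "\<not> extremal_coupling \<mu> \<nu> Q"
proof
  assume ext: "extremal_coupling \<mu> \<nu> Q"
  have "\<forall>i\<in>{1..n}. \<exists>w. finite (C i) \<and> (\<forall>p. w p \<noteq> 0 \<longleftrightarrow> p \<in> C i) \<and>
      (\<forall>g. (\<Sum>p\<in>C i. w p * g (fst p)) = 0) \<and> (\<forall>g. (\<Sum>p\<in>C i. w p * g (snd p)) = (0 :: real))"
  proof
    fix i assume "i \<in> {1..n}"
    with assms(16) have "classical_cycle (coupling_support X Y Q) (C i)" by blast
    then show "\<exists>w. finite (C i) \<and> (\<forall>p. w p \<noteq> 0 \<longleftrightarrow> p \<in> C i) \<and>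
      (\<forall>g. (\<Sum>p\<in>C i. w p * g (fst p)) = 0) \<and> (\<forall>g. (\<Sum>p\<in>C i. w p * g (snd p)) = (0 :: real))"
      by (rule classical_cycle_weight) blast
  qed
  from bchoice[OF this] obtain W where "\<forall>i\<in>{1..n}. finite (C i) \<and>
      (\<forall>p. W i p \<noteq> 0 \<longleftrightarrow> p \<in> C i) \<and> (\<forall>g. (\<Sum>p\<in>C i. W i p * g (fst p)) = 0) \<and>
      (\<forall>g. (\<Sum>p\<in>C i. W i p * g (snd p)) = (0 :: real))"
    by (rule exE)
  then have W: "\<And>i. i \<in> {1..n} \<Longrightarrow> finite (C i)"
      "\<And>i p. i \<in> {1..n} \<Longrightarrow> W i p \<noteq> 0 \<longleftrightarrow> p \<in> C i"
      "\<And>i g. i \<in> {1..n} \<Longrightarrow> (\<Sum>p\<in>C i. W i p * g (fst p)) = 0"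
      "\<And>i g. i \<in> {1..n} \<Longrightarrow> (\<Sum>p\<in>C i. W i p * g (snd p)) = 0"
    by blast+
  define F where "F = (\<Union>i\<in>{1..n}. C i)"
  have F: "finite F" using W(1) by (auto simp: F_def)
  \<comment> \<open>\<open>W i\<close> vanishes off \<open>C i\<close>, so all weights can be summed
    over the common set \<open>F\<close>.\<close>
  have extend: "(\<Sum>p\<in>F. W i p * g p) = (\<Sum>p\<in>C i. W i p * g p)" if "i \<in> {1..n}" for i g
    using that W(2) F by (intro sum.mono_neutral_right) (auto simp: F_def)
  \<comment> \<open>\<open>v i x\<close> is the first moment of the weight \<open>W i\<close> in row
    \<open>x\<close>.\<close>
  define v where "v = (\<lambda>i x. \<Sum>p\<in>F. W i p * (of_bool (fst p = x) * snd p))"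
  have A: "(\<Union>i\<in>{1..n}. X_section (C i)) = fst ` F"
    by (auto simp: F_def X_section_def)
  \<comment> \<open>Summing over the rows leaves the column sums of \<open>W i\<close> tested
    against the identity. This is the dependence among the \<open>n\<close> equations.\<close>
  have v_sum: "(\<Sum>x\<in>fst ` F. v i x) = 0" if i: "i \<in> {1..n}" for i
  proof -
    have "(\<Sum>x\<in>fst ` F. v i x) = (\<Sum>p\<in>F. \<Sum>x\<in>fst ` F. W i p * (of_bool (fst p = x) * snd p))"
      unfolding v_def by (rule sum.swap)
    also have "\<dots> = (\<Sum>p\<in>F. W i p * snd p)"
    proof (rule sum.cong)
      fix p assume "p \<in> F"
      then have "(\<Sum>x\<in>fst ` F. of_bool (fst p = x)) = (1::real)"
        using F by (subst sum.remove[of _ "fst p"]) (auto intro!: sum.neutral)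
      then show "(\<Sum>x\<in>fst ` F. W i p * (of_bool (fst p = x) * snd p)) = W i p * snd p"
        by (simp flip: sum_distrib_left sum_distrib_right)
    qed simp
    also have "\<dots> = 0" using W(4)[OF i, of "\<lambda>y. y"] by (simp add: extend[OF i])
    finally show ?thesis .
  qed
  have "card (fst ` F) = n" using assms(17) by (simp only: A)
  then obtain x0 where x0: "x0 \<in> fst ` F" using assms(15) by fastforce
  \<comment> \<open>Leaving out the row \<open>x0\<close> makes the count strict:
    \<open>n - 1\<close> equations for \<open>n\<close> coefficients.\<close>
  have "card (fst ` F - {x0}) < card {1..n}"
    using \<open>card (fst ` F) = n\<close> x0 F assms(15) by simp
  then obtain l where l: "\<exists>i\<in>{1..n}. l i \<noteq> 0"
      and "\<forall>x\<in>fst ` F - {x0}. (\<Sum>i\<in>{1..n}. l i * v i x) = 0"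
    using underdetermined_linear_system[of "fst ` F - {x0}" "{1..n}" v] F by auto
  \<comment> \<open>By \<open>v_sum\<close> the omitted equation follows from the others.\<close>
  moreover have "(\<Sum>i\<in>{1..n}. l i * v i x0) = - (\<Sum>x\<in>fst ` F - {x0}. \<Sum>i\<in>{1..n}. l i * v i x)"
  proof -
    have "(\<Sum>x\<in>fst ` F. \<Sum>i\<in>{1..n}. l i * v i x) = (\<Sum>i\<in>{1..n}. l i * (\<Sum>x\<in>fst ` F. v i x))"
      by (subst sum.swap) (simp add: sum_distrib_left)
    also have "\<dots> = 0" using v_sum by (intro sum.neutral) auto
    finally show ?thesis using sum.remove[OF finite_imageI[OF F] x0, of "\<lambda>x. \<Sum>i\<in>{1..n}. l i * v i x"]
      by simp
  qed
  ultimately have lv: "(\<Sum>i\<in>{1..n}. l i * v i x) = 0" if "x \<in> fst ` F" for x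
    using that by (cases "x = x0") auto
  define w where "w = (\<lambda>p. \<Sum>i\<in>{1..n}. l i * W i p)"
  have w_sum: "(\<Sum>p\<in>F. w p * g p) = (\<Sum>i\<in>{1..n}. l i * (\<Sum>p\<in>F. W i p * g p))" for g
    unfolding w_def sum_distrib_right by (subst sum.swap) (simp add: sum_distrib_left mult.assoc)
  have row: "(\<Sum>p\<in>F. w p * g (fst p)) = 0" and col: "(\<Sum>p\<in>F. w p * g (snd p)) = 0" for g
    unfolding w_sum by (auto intro!: sum.neutral simp: extend W)
  have bary: "(\<Sum>p\<in>F. w p * (of_bool (fst p = x) * snd p)) = 0" for x
  proof (cases "x \<in> fst ` F")
    case True
    then show ?thesis using lv[of x] by (simp add: w_sum v_def)
  next
    case False
    then have "fst p \<noteq> x" if "p \<in> F" for p using that by blast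
    then show ?thesis by simp
  qed
  \<comment> \<open>On a path belonging to \<open>C i\<close> alone, with
    \<open>l i \<noteq> 0\<close>, only the weight \<open>W i\<close> contributes to
    \<open>w\<close>, so nothing can cancel.\<close>
  obtain p0 where p0: "p0 \<in> F" "w p0 \<noteq> 0"
  proof -
    from l obtain i where i: "i \<in> {1..n}" "l i \<noteq> 0" by blast
    with assms(18) obtain p where p: "p \<in> C i" "\<And>k. k \<in> {1..n} \<Longrightarrow> k \<noteq> i \<Longrightarrow> p \<notin> C k" by blast
    have "w p = l i * W i p + (\<Sum>k\<in>{1..n} - {i}. l k * W k p)"
      unfolding w_def by (rule sum.remove) (use i in auto)
    also have "(\<Sum>k\<in>{1..n} - {i}. l k * W k p) = 0"
    proof (rule sum.neutral, rule ballI)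
      fix k assume "k \<in> {1..n} - {i}"
      then show "l k * W k p = 0" using p(2)[of k] W(2)[of k p] by auto
    qed
    finally have "w p \<noteq> 0" using i W(2)[OF i(1), of p] p by auto
    with p(1) i(1) show ?thesis by (intro that[of p]) (auto simp: F_def)
  qed
  have supp: "F \<subseteq> coupling_support X Y Q"
  proof -
    have "D \<subseteq> S" if "classical_cycle S D" for S D :: "(real \<times> real) set"
      using that unfolding classical_cycle_def by blast
    with assms(16) show ?thesis unfolding F_def by (intro UN_least) blast
  qed
  then have pos: "measure Q {p} > 0" if "p \<in> F" for p
    using that by (auto simp: coupling_support_def)
  have F_nonneg: "F \<subseteq> {0..} \<times> {0..}"
    using supp assms(6,9) unfolding coupling_support_def by blast
  \<comment> \<open>The summand \<open>1\<close> avoids division by zero where \<open>w\<close>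
    vanishes; the minimum is over a nonempty set, as \<open>p0\<close> lies in
    \<open>F\<close>.\<close>
  define e where "e = Min ((\<lambda>p. measure Q {p} / (1 + \<bar>w p\<bar>)) ` F)"
  have e: "e > 0"
    unfolding e_def using p0 F pos by (subst Min_gr_iff) (auto intro!: divide_pos_pos add_pos_nonneg)
  have small: "e * \<bar>w p\<bar> \<le> measure Q {p}" if "p \<in> F" for p
  proof -
    have "e \<le> measure Q {p} / (1 + \<bar>w p\<bar>)"
      unfolding e_def using F that by (intro Min_le) auto
    then have "e * (1 + \<bar>w p\<bar>) \<le> measure Q {p}"
      by (simp add: pos_le_divide_eq add_pos_nonneg)
    with e show ?thesis by (simp add: algebra_simps)
  qed
  \<comment> \<open>The sign \<open>s\<close> yields both perturbations at once; \<open>Q\<close> is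
    their midpoint.\<close>
  have perturb: "\<exists>Q' \<in> martingale_couplings \<mu> \<nu>. \<forall>A\<in>sets Q.
      measure Q' A = measure Q A + s * e * (\<Sum>p\<in>F. w p * indicator A p)" if s: "\<bar>s\<bar> = 1" for s
  proof (rule martingale_coupling_perturb[OF assms(1,2,14) F F_nonneg pos, of "\<lambda>p. s * e * w p"])
    show "\<bar>s * e * w p\<bar> \<le> measure Q {p}" if "p \<in> F" for p
      using small[OF that] e s by (simp add: abs_mult)
  qed (auto simp: mult.assoc row col bary simp flip: sum_distrib_left)
  from perturb[of 1] perturb[of "- 1"] obtain Q1 Q2 where
    Q12: "Q1 \<in> martingale_couplings \<mu> \<nu>" "Q2 \<in> martingale_couplings \<mu> \<nu>"
    and Q1: "\<And>A. A \<in> sets Q \<Longrightarrow> measure Q1 A = measure Q A + e * (\<Sum>p\<in>F. w p * indicator A p)"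
    and Q2: "\<And>A. A \<in> sets Q \<Longrightarrow> measure Q2 A = measure Q A - e * (\<Sum>p\<in>F. w p * indicator A p)"
    by auto
  have "\<forall>A\<in>sets Q. measure Q A = 1 / 2 * measure Q1 A + (1 - 1 / 2) * measure Q2 A"
    by (simp add: Q1 Q2 field_simps)
  moreover from ext Q12 have "(0 :: real) < 1 / 2 \<longrightarrow> (1 / 2 :: real) < 1 \<longrightarrow>
      (\<forall>A\<in>sets Q. measure Q A = 1 / 2 * measure Q1 A + (1 - 1 / 2) * measure Q2 A) \<longrightarrow>
      Q = Q1 \<and> Q = Q2"
    unfolding extremal_coupling_def by blast
  ultimately have "Q = Q1" by simp
  have "{p0} \<in> sets Q"
    using pos[OF p0(1)] by (rule_tac ccontr) (simp add: measure_notin_sets)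
  \<comment> \<open>\<open>Q = Q1\<close> would mean that the perturbation leaves the mass of
    \<open>p0\<close> unchanged, whereas it changes by \<open>e * w p0\<close>.\<close>
  then have "e * (\<Sum>p\<in>F. w p * indicator {p0} p) = 0"
    using Q1[of "{p0}"] by (simp flip: \<open>Q = Q1\<close>)
  moreover have "(\<Sum>p\<in>F. w p * indicator {p0} p) = w p0"
    using F p0 by (simp add: indicator_def sum.delta)
  ultimately show False using e p0 by simp
qed

end
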